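(* Let $q=\sum_{j=0}^{p}b_jz_\infty^{-\alpha_j/\beta}$ be an exponential factor at infinity with ramification order $\beta$, all $b_j\ne0$, $\alpha_0>\dots>\alpha_p$, of slope $\alpha_0/\beta>1$; put $\alpha=\alpha_0$ and $I=\langle q\rangle$. Write $(\cdot,\dots,\cdot)$ for greatest common divisors. 1. One has $$B_{I,I}=(\beta-(\alpha_0,\beta))\alpha_0+((\alpha_0,\beta)-(\alpha_0,\alpha_1,\beta))\alpha_1+\dots+((\alpha_0,\dots,\alpha_{p-1},\beta)-(\alpha_0,\dots,\alpha_p,\beta))\alpha_p-\beta^2+1.$$ 2. In particular, if $(\alpha,\beta)=1$, then $B_{I,I}=(\beta-1)(\alpha-\beta-1)$.
   Context: Let $z_\infty=1/z$. An exponential factor at infinity is a polynomial without constant term in $z_\infty^{-1/\beta}$ for some $\beta\ge 1$; the smallest possible $\beta$ is its ramification order, its degree in $z_\infty^{-1/\beta}$ is its irregularity, and its slope is irregularity divided by ramification (slope of $0$ is $0$). Its Galois conjugates $q_i$ ($i=0,\dots,\beta-1$) are obtained by $z_\infty^{1/\beta}\mapsto\omega z_\infty^{1/\beta}$ with $\omega^\beta=1$, and the circle $\langle q\rangle$ is its Galois orbit. The number of (oriented) loops at $I=\langle q\rangle$ is defined as $$B_{I,I}=\mathrm{Irr}(\mathrm{End}(I))-\beta^2+1,\qquad \mathrm{Irr}(\mathrm{End}(I))=\sum_{i=0}^{\beta-1}\sum_{j=0}^{\beta-1}\mathrm{slope}(q_i-q_j).$$ *)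

theory Defs
  imports Complex_Main "HOL-Library.Poly_Mapping" "HOL-Computational_Algebra.Polynomial"
begin

text \<open>
  A finite sum of complex multiples of rational powers of \<open>z\<^sub>\<infinity>\<close>, as a finitely supported function
  sending the exponent of \<open>z\<^sub>\<infinity>\<close> to its coefficient. All the rings of polynomials in
  \<open>z\<^sub>\<infinity>\<^bsup>-1/\<beta>\<^esup>\<close>, for varying \<open>\<beta>\<close>, embed in this one type, so that exponential factors of
  different ramification can be compared and subtracted.
\<close>
type_synonym puiseux = "rat \<Rightarrow>\<^sub>0 complex"

text \<open>The polynomial \<open>P\<close> evaluated at \<open>z\<^sub>\<infinity>\<^bsup>-1/\<beta>\<^esup>\<close>.\<close>
definition at_root :: "nat \<Rightarrow> complex poly \<Rightarrow> puiseux" where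
  "at_root \<beta> P = (\<Sum>i\<le>degree P. Poly_Mapping.single (- (of_nat i / of_nat \<beta>)) (coeff P i))"

definition exp_factor_in_root :: "nat \<Rightarrow> puiseux \<Rightarrow> bool" where
  "exp_factor_in_root \<beta> q \<longleftrightarrow> \<beta> \<ge> 1 \<and> (\<exists>P. coeff P 0 = 0 \<and> q = at_root \<beta> P)"

definition exp_factor :: "puiseux \<Rightarrow> bool" where
  "exp_factor q \<longleftrightarrow> (\<exists>\<beta>. exp_factor_in_root \<beta> q)"

definition ram :: "puiseux \<Rightarrow> nat" where
  "ram q = (LEAST \<beta>. exp_factor_in_root \<beta> q)"

text \<open>The polynomial in \<open>z\<^sub>\<infinity>\<^bsup>-1/\<beta>\<^esup>\<close>, for \<open>\<beta>\<close> the ramification order; it is unique by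
  injectivity of \<open>at_root \<beta>\<close>, proved below.\<close>
definition ram_poly :: "puiseux \<Rightarrow> complex poly" where
  "ram_poly q = (THE P. q = at_root (ram q) P)"

definition irregularity :: "puiseux \<Rightarrow> nat" where
  "irregularity q = degree (ram_poly q)"

definition slope :: "puiseux \<Rightarrow> rat" where
  "slope q = of_nat (irregularity q) / of_nat (ram q)"

text \<open>The \<open>i\<close>-th conjugate substitutes \<open>\<omega>\<^sup>i z\<^sub>\<infinity>\<^bsup>1/\<beta>\<^esup>\<close> for \<open>z\<^sub>\<infinity>\<^bsup>1/\<beta>\<^esup>\<close>, where
  \<open>\<omega> = exp (2 \<pi> \<i> / \<beta>)\<close>; the polynomial variable is \<open>z\<^sub>\<infinity>\<^bsup>-1/\<beta>\<^esup>\<close>, hence the inverse.\<close>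
definition galois_conj :: "puiseux \<Rightarrow> nat \<Rightarrow> puiseux" where
  "galois_conj q i =
     at_root (ram q) (ram_poly q \<circ>\<^sub>p [:0, inverse (cis (2 * pi / real (ram q)) ^ i):])"

definition circle :: "puiseux \<Rightarrow> puiseux set" where
  "circle q = galois_conj q ` {..<ram q}"

text \<open>Quantities attached to a circle are computed from a representative; the choice does not
  matter, since another one only shifts the numbering of the conjugates cyclically.\<close>
definition circle_rep :: "puiseux set \<Rightarrow> puiseux" where
  "circle_rep I = (SOME q. exp_factor q \<and> circle q = I)"

definition circle_ram :: "puiseux set \<Rightarrow> nat" where
  "circle_ram I = ram (circle_rep I)"

definition Irr_End :: "puiseux set \<Rightarrow> rat" where
  "Irr_End I = (\<Sum>i<circle_ram I. \<Sum>j<circle_ram I.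
     slope (galois_conj (circle_rep I) i - galois_conj (circle_rep I) j))"

definition num_loops :: "puiseux set \<Rightarrow> rat" where
  "num_loops I = Irr_End I - (of_nat (circle_ram I))\<^sup>2 + 1"

lemma lookup_at_root:
  assumes "\<beta> \<ge> 1"
  shows "Poly_Mapping.lookup (at_root \<beta> P) (- (of_nat k / of_nat \<beta>)) = coeff P k"
proof -
  have "Poly_Mapping.lookup (at_root \<beta> P) (- (of_nat k / of_nat \<beta>))
      = (\<Sum>i\<le>degree P. if i = k then coeff P i else 0)"
    unfolding at_root_def lookup_sum
    by (rule sum.cong) (use assms in \<open>auto simp: lookup_single when_def field_simps\<close>)
  also have "\<dots> = coeff P k"
    by (auto simp: sum.delta coeff_eq_0)
  finally show ?thesis .
qed

lemma at_root_inject: "\<beta> \<ge> 1 \<Longrightarrow> at_root \<beta> P = at_root \<beta> Q \<longleftrightarrow> P = Q"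
  by (metis lookup_at_root poly_eqI)

end

theory Submission
  imports Defs "HOL-Number_Theory.Cong"
begin

text \<open>
  The difference of the \<open>i\<close>-th and \<open>j\<close>-th conjugates keeps the monomial of exponent \<open>\<alpha>\<^sub>k\<close> iff
  \<open>\<beta>\<close> does not divide \<open>(i - j) \<alpha>\<^sub>k\<close>, so its slope is \<open>\<alpha>\<^sub>k / \<beta>\<close> for the first such \<open>k\<close>. All of
  \<open>\<alpha>\<^sub>0, \<dots>, \<alpha>\<^bsub>k-1\<^esub>\<close> drop out iff \<open>\<beta>\<close> divides \<open>(i - j) g\<close> with
  \<open>g = (\<alpha>\<^sub>0, \<dots>, \<alpha>\<^bsub>k-1\<^esub>, \<beta>)\<close>, which happens for \<open>\<beta> g\<close> pairs \<open>(i, j)\<close>; the formula follows by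
  counting pairs according to \<open>k\<close>.
\<close>

section \<open>Exponential factors through their exponents\<close>

text \<open>Injectivity of \<open>f\<close> keeps the terms at distinct exponents, so none merge or
  cancel.\<close>

lemma keys_sum_single:
  assumes "finite A" "inj_on f A" "\<And>x. x \<in> A \<Longrightarrow> c x \<noteq> 0"
  shows "Poly_Mapping.keys (\<Sum>x\<in>A. Poly_Mapping.single (f x) (c x)) = f ` A"
proof -
  have "Poly_Mapping.lookup (\<Sum>x\<in>A. Poly_Mapping.single (f x) (c x)) (f y) = c y" if "y \<in> A" for y
  proof -
    have "Poly_Mapping.lookup (\<Sum>x\<in>A. Poly_Mapping.single (f x) (c x)) (f y) =
            (\<Sum>x\<in>A. if x = y then c x else 0)"
      unfolding lookup_sum
      by (rule sum.cong)
        (use assms(2) that in \<open>auto simp: lookup_single when_def inj_on_eq_iff\<close>)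
    then show ?thesis
      using assms(1) that by simp
  qed
  moreover have "Poly_Mapping.lookup (\<Sum>x\<in>A. Poly_Mapping.single (f x) (c x)) z = 0"
    if "z \<notin> f ` A" for z
    unfolding lookup_sum by (rule sum.neutral) (use that in \<open>auto simp: lookup_single when_def\<close>)
  ultimately show ?thesis
    using assms(3) by (fastforce simp: in_keys_iff set_eq_iff)
qed

lemma lookup_at_root_eq_0:
  assumes "\<And>k. x \<noteq> - (of_nat k / of_nat \<beta>)"
  shows "Poly_Mapping.lookup (at_root \<beta> P) x = 0"
  unfolding at_root_def lookup_sum
  by (rule sum.neutral) (use assms in \<open>auto simp: lookup_single when_def\<close>)

text \<open>The coefficients of \<open>P\<close> can be read off from \<open>q\<close>, so only the
  support matters; \<open>k \<ge> 1\<close> encodes the missing constant term. Hence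
  \<open>exp_factor\<close> and \<open>ram\<close> can be handled through \<open>keys\<close>
  alone.\<close>

lemma exp_factor_in_root_iff:
  "exp_factor_in_root \<beta> q \<longleftrightarrow>
     \<beta> \<ge> 1 \<and> (\<forall>x\<in>Poly_Mapping.keys q. \<exists>k\<ge>1. x = - (of_nat k / of_nat \<beta>))"
proof (intro iffI conjI ballI)
  assume "exp_factor_in_root \<beta> q"
  then obtain P where \<beta>: "\<beta> \<ge> 1" and P: "coeff P 0 = 0" "q = at_root \<beta> P"
    by (auto simp: exp_factor_in_root_def)
  show "\<beta> \<ge> 1" by fact
  fix x assume "x \<in> Poly_Mapping.keys q"
  then have nz: "Poly_Mapping.lookup (at_root \<beta> P) x \<noteq> 0"
    by (simp add: P in_keys_iff)
  then obtain k where k: "x = - (of_nat k / of_nat \<beta>)"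
    using lookup_at_root_eq_0 by blast
  then have "k \<ge> 1"
    using nz P \<beta> lookup_at_root[of \<beta> P k] by (cases k) auto
  with k show "\<exists>k\<ge>1. x = - (of_nat k / of_nat \<beta>)" by blast
next
  assume A: "\<beta> \<ge> 1 \<and> (\<forall>x\<in>Poly_Mapping.keys q. \<exists>k\<ge>1. x = - (of_nat k / of_nat \<beta>))"
  let ?f = "\<lambda>k. Poly_Mapping.lookup q (- (of_nat k / of_nat \<beta>))"
  have inj: "inj (\<lambda>k. - (of_nat k / of_nat \<beta> :: rat))"
    using A by (auto intro!: injI)
  \<comment> \<open>\<open>Abs_poly\<close> is meaningful only for almost everywhere zero sequences;
    finiteness is pulled back from the support of \<open>q\<close>.\<close>
  have "finite ((\<lambda>k. - (of_nat k / of_nat \<beta> :: rat)) -` Poly_Mapping.keys q)"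
    by (intro finite_vimageI inj) simp
  then have "finite {k. ?f k \<noteq> 0}"
    by (simp add: vimage_def in_keys_iff)
  then have coeff: "coeff (Abs_poly ?f) k = ?f k" for k
    by (subst Abs_poly_inverse) (auto simp: MOST_iff_cofinite)
  have "q = at_root \<beta> (Abs_poly ?f)"
  proof (rule poly_mapping_eqI)
    fix x
    show "Poly_Mapping.lookup q x = Poly_Mapping.lookup (at_root \<beta> (Abs_poly ?f)) x"
    proof (cases "\<exists>k. x = - (of_nat k / of_nat \<beta>)")
      case True
      then show ?thesis using A by (auto simp: lookup_at_root coeff)
    next
      case False
      then show ?thesis
        using A lookup_at_root_eq_0[of x \<beta>] by (auto simp: in_keys_iff)
    qed
  qed
  moreover have "coeff (Abs_poly ?f) 0 = 0"
  proof (rule ccontr)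
    assume "coeff (Abs_poly ?f) 0 \<noteq> 0"
    then have "0 \<in> Poly_Mapping.keys q"
      by (simp add: coeff in_keys_iff)
    then show False
      using A by fastforce
  qed
  ultimately show "exp_factor_in_root \<beta> q"
    using A by (auto simp: exp_factor_in_root_def)
qed

lemma exp_factor_keys_subset:
  assumes "exp_factor q" "Poly_Mapping.keys r \<subseteq> Poly_Mapping.keys q"
  shows "exp_factor r"
  using assms unfolding exp_factor_def exp_factor_in_root_iff by blast

lemma ram_keys_cong:
  assumes "Poly_Mapping.keys r = Poly_Mapping.keys q"
  shows "ram r = ram q"
  unfolding ram_def exp_factor_in_root_iff assms ..

lemma exp_factor_in_root_ram: "exp_factor q \<Longrightarrow> exp_factor_in_root (ram q) q"
  unfolding exp_factor_def ram_def by (auto intro: LeastI)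

lemma ram_pos: "exp_factor q \<Longrightarrow> ram q > 0"
  using exp_factor_in_root_ram[of q] by (simp add: exp_factor_in_root_def)

lemma exp_factor_keysE:
  assumes "exp_factor q" "x \<in> Poly_Mapping.keys q"
  obtains k where "k \<ge> 1" "x = - (of_nat k / of_nat (ram q))"
  using exp_factor_in_root_ram[OF assms(1)] assms(2) by (auto simp: exp_factor_in_root_iff)

lemma at_root_ram_poly:
  assumes "exp_factor q"
  shows "at_root (ram q) (ram_poly q) = q"
proof -
  obtain P where P: "q = at_root (ram q) P"
    using exp_factor_in_root_ram[OF assms] by (auto simp: exp_factor_in_root_def)
  have "q = at_root (ram q) (ram_poly q)"
    unfolding ram_poly_def
  proof (rule theI[where a = P])
    show "R = P" if "q = at_root (ram q) R" for R
      using that P ram_pos[OF assms] by (simp add: Suc_le_eq flip: at_root_inject[of "ram q"])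
  qed fact
  then show ?thesis ..
qed

lemma coeff_ram_poly:
  assumes "exp_factor q"
  shows "coeff (ram_poly q) k = Poly_Mapping.lookup q (- (of_nat k / of_nat (ram q)))"
  using lookup_at_root[of "ram q" "ram_poly q" k] ram_pos[OF assms]
  by (simp add: at_root_ram_poly[OF assms])

text \<open>Keys are exponents of z_infinity itself, so the top degree in its negative root
  corresponds to the least key. This gives the slope of a difference of conjugates without computing
  its ramification order, which may be smaller than that of the conjugates.\<close>

lemma slope_eqI:
  assumes q: "exp_factor q" and s: "- s \<in> Poly_Mapping.keys q"
    and min: "\<And>x. x \<in> Poly_Mapping.keys q \<Longrightarrow> - s \<le> x"
  shows "slope q = s"
proof -
  note pos = ram_pos[OF q]
  obtain k where k: "- s = - (of_nat k / of_nat (ram q))"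
    using exp_factor_keysE[OF q s] by metis
  have "degree (ram_poly q) = k"
  proof (rule antisym)
    show "degree (ram_poly q) \<le> k"
    proof (rule degree_le, intro allI impI)
      fix m assume "k < m"
      then have "\<not> - s \<le> - (of_nat m / of_nat (ram q))"
        using pos unfolding k by (simp add: divide_le_cancel)
      then show "coeff (ram_poly q) m = 0"
        using min unfolding coeff_ram_poly[OF q] in_keys_iff by blast
    qed
    show "k \<le> degree (ram_poly q)"
      using s k by (intro le_degree) (simp add: coeff_ram_poly[OF q] in_keys_iff)
  qed
  then show ?thesis
    using k by (simp add: slope_def irregularity_def)
qed

text \<open>The empty support has no least key; here the convention \<open>degree 0 = 0\<close>
  gives the slope.\<close>

lemma slope_0 [simp]: "slope 0 = 0"
proof -
  have "exp_factor 0"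
    unfolding exp_factor_def exp_factor_in_root_iff by auto
  then have "ram_poly 0 = 0"
    by (intro poly_eqI) (simp add: coeff_ram_poly)
  then show ?thesis
    by (simp add: slope_def irregularity_def)
qed

section \<open>Galois conjugates\<close>

text \<open>The root of unity has \<open>n\<close>-th power 1, so exponents reduce modulo
  \<open>n\<close>; below \<open>n\<close> its powers enumerate the distinct \<open>n\<close>-th
  roots of unity.\<close>

lemma cis_power_eq_iff_cong:
  assumes "n > 0"
  shows "cis (2 * pi / real n) ^ a = cis (2 * pi / real n) ^ b \<longleftrightarrow> [a = b] (mod n)"
proof -
  let ?w = "cis (2 * pi / real n)"
  have "?w ^ n = 1"
    using assms by (simp add: Complex.DeMoivre)
  then have red: "?w ^ m = ?w ^ (m mod n)" for m
    by (metis mult_div_mod_eq power_add power_mult power_one mult_1)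
  have "inj_on (\<lambda>k. ?w ^ k) {..<n}"
    using bij_betw_imp_inj_on[OF bij_betw_roots_unity[OF assms]]
    by (simp add: Complex.DeMoivre mult_ac)
  then have "?w ^ (a mod n) = ?w ^ (b mod n) \<longleftrightarrow> a mod n = b mod n"
    using assms by (intro inj_on_eq_iff) auto
  then show ?thesis
    by (simp add: cong_def flip: red)
qed

lemma lookup_galois_conj:
  assumes "exp_factor q"
  shows "Poly_Mapping.lookup (galois_conj q i) (- (of_nat k / of_nat (ram q))) =
           inverse (cis (2 * pi / real (ram q)) ^ (i * k)) *
           Poly_Mapping.lookup q (- (of_nat k / of_nat (ram q)))"
  using ram_pos[OF assms]
  by (simp add: galois_conj_def lookup_at_root coeff_pcompose_linear coeff_ram_poly[OF assms]
      power_mult power_inverse Suc_le_eq)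

text \<open>Conjugation only scales each coefficient by a root of unity, which is nonzero.\<close>

lemma keys_galois_conj:
  assumes "exp_factor q"
  shows "Poly_Mapping.keys (galois_conj q i) = Poly_Mapping.keys q"
proof (rule set_eqI)
  fix x
  show "x \<in> Poly_Mapping.keys (galois_conj q i) \<longleftrightarrow> x \<in> Poly_Mapping.keys q"
  proof (cases "\<exists>k. x = - (of_nat k / of_nat (ram q))")
    case True
    then show ?thesis
      by (auto simp: in_keys_iff lookup_galois_conj[OF assms])
  next
    case False
    then show ?thesis
      using exp_factor_keysE[OF assms, of x]
      by (auto simp: in_keys_iff galois_conj_def lookup_at_root_eq_0)
  qed
qed

text \<open>The two conjugates scale a coefficient by powers of one primitive root of unity, so it
  cancels exactly when it is zero or these powers agree.\<close>

lemma keys_galois_conj_diff: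
  assumes "exp_factor q"
  shows "- (of_nat k / of_nat (ram q)) \<in> Poly_Mapping.keys (galois_conj q i - galois_conj q j) \<longleftrightarrow>
           - (of_nat k / of_nat (ram q)) \<in> Poly_Mapping.keys q \<and> \<not> [i * k = j * k] (mod ram q)"
  by (simp add: in_keys_iff lookup_minus lookup_galois_conj[OF assms]
      flip: cis_power_eq_iff_cong[OF ram_pos[OF assms]])

lemma galois_conj_0:
  assumes "exp_factor q"
  shows "galois_conj q 0 = q"
  by (simp add: galois_conj_def at_root_ram_poly[OF assms])

text \<open>The representative is its own zeroth conjugate, hence lies in the circle and is a
  conjugate of \<open>q\<close>. Sharing the support of \<open>q\<close> suffices, since the count
  below depends on nothing else.\<close>

lemma exp_factor_circle_rep:
  assumes "exp_factor q"
  shows "exp_factor (circle_rep (circle q))"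
    and "Poly_Mapping.keys (circle_rep (circle q)) = Poly_Mapping.keys q"
proof -
  define r where "r = circle_rep (circle q)"
  have r: "exp_factor r \<and> circle r = circle q"
    unfolding r_def circle_rep_def by (rule someI[of _ q]) (use assms in auto)
  then show "exp_factor (circle_rep (circle q))"
    by (simp add: r_def)
  have "galois_conj r 0 \<in> circle r"
    unfolding circle_def using r ram_pos[of r] by blast
  then have "r \<in> circle q"
    using r galois_conj_0[of r] by simp
  then obtain i where "r = galois_conj q i"
    unfolding circle_def by blast
  then show "Poly_Mapping.keys (circle_rep (circle q)) = Poly_Mapping.keys q"
    using keys_galois_conj[OF assms] by (simp flip: r_def)
qed

text \<open>\<open>C k i j\<close> says that the first \<open>k\<close> monomials cancel, a
  condition that can only be lost as \<open>k\<close> grows. The difference of indicators is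
  therefore 1 only at the first surviving exponent, and this linear form can be summed over
  \<open>i\<close> and \<open>j\<close>.\<close>

lemma slope_galois_conj_diff:
  fixes \<alpha> :: "nat \<Rightarrow> nat"
  assumes q: "exp_factor q" "ram q = \<beta>"
    and keys: "Poly_Mapping.keys q = (\<lambda>m. - (of_nat (\<alpha> m) / of_nat \<beta>)) ` {..p}"
    and dec: "\<And>i j. i < j \<Longrightarrow> j \<le> p \<Longrightarrow> \<alpha> j < \<alpha> i"
  defines "C \<equiv> \<lambda>k i j. \<forall>m<k. [i * \<alpha> m = j * \<alpha> m] (mod \<beta>)"
  shows "slope (galois_conj q i - galois_conj q j) =
           (\<Sum>k\<le>p. of_nat (\<alpha> k) / of_nat \<beta> * (of_bool (C k i j) - of_bool (C (Suc k) i j)))"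
    (is "slope ?d = ?S")
proof -
  have sub: "Poly_Mapping.keys ?d \<subseteq> Poly_Mapping.keys q"
    using keys_diff[of "galois_conj q i" "galois_conj q j"] by (simp add: keys_galois_conj[OF q(1)])
  have mem: "- (of_nat m / of_nat \<beta>) \<in> Poly_Mapping.keys ?d \<longleftrightarrow>
      - (of_nat m / of_nat \<beta>) \<in> Poly_Mapping.keys q \<and> \<not> [i * m = j * m] (mod \<beta>)" for m
    using keys_galois_conj_diff[OF q(1), of m i j] unfolding q(2) .
  show ?thesis
  proof (cases "C (Suc p) i j")
    case True
    have "x \<notin> Poly_Mapping.keys ?d" for x
    proof
      assume x: "x \<in> Poly_Mapping.keys ?d"
      then obtain m where m: "m \<le> p" "x = - (of_nat (\<alpha> m) / of_nat \<beta>)"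
        using sub keys by blast
      then show False
        using True x mem[of "\<alpha> m"] by (simp add: C_def)
    qed
    then have "Poly_Mapping.keys ?d = {}" by blast
    then have "?d = 0" by simp
    moreover have "?S = 0"
      using True by (intro sum.neutral) (auto simp: C_def)
    ultimately show ?thesis by simp
  next
    case False
    \<comment> \<open>The first index that survives carries the largest surviving exponent, as
      \<alpha> decreases.\<close>
    define n where "n = (LEAST m. \<not> [i * \<alpha> m = j * \<alpha> m] (mod \<beta>))"
    from False obtain m where m: "m \<le> p" "\<not> [i * \<alpha> m = j * \<alpha> m] (mod \<beta>)"
      by (auto simp: C_def less_Suc_eq_le)
    have n: "\<not> [i * \<alpha> n = j * \<alpha> n] (mod \<beta>)"
      unfolding n_def by (rule LeastI) fact
    have n_le: "n \<le> m'" if "\<not> [i * \<alpha> m' = j * \<alpha> m'] (mod \<beta>)" for m'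
      unfolding n_def by (rule Least_le) fact
    have np: "n \<le> p"
      using n_le[OF m(2)] m(1) by simp
    have C_iff: "C k i j \<longleftrightarrow> k \<le> n" for k
      unfolding C_def using n n_le by (meson leD leI less_le_trans)
    have "slope ?d = of_nat (\<alpha> n) / of_nat \<beta>"
    proof (rule slope_eqI)
      show "exp_factor ?d"
        using exp_factor_keys_subset[OF q(1) sub] .
      show "- (of_nat (\<alpha> n) / of_nat \<beta>) \<in> Poly_Mapping.keys ?d"
        using mem n np keys by blast
      fix x assume x: "x \<in> Poly_Mapping.keys ?d"
      then obtain m' where m': "m' \<le> p" "x = - (of_nat (\<alpha> m') / of_nat \<beta>)"
        using sub keys by blast
      then have "n \<le> m'"
        using x mem[of "\<alpha> m'"] by (intro n_le) simp
      then have "\<alpha> m' \<le> \<alpha> n"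
        using dec[of n m'] m'(1) by (cases "n = m'") auto
      then show "- (of_nat (\<alpha> n) / of_nat \<beta>) \<le> x"
        by (simp add: m'(2) divide_right_mono)
    qed
    moreover have "?S = (\<Sum>k\<le>p. if k = n then of_nat (\<alpha> k) / of_nat \<beta> else 0)"
      by (intro sum.cong) (auto simp: C_iff of_bool_def)
    ultimately show ?thesis
      using np by simp
  qed
qed

section \<open>Counting pairs of conjugates\<close>

text \<open>All congruences together say that \<open>n\<close> divides every \<open>d * a\<close>
  with \<open>d\<close> the distance of \<open>i\<close> and \<open>j\<close>, hence divides
  \<open>d\<close> times the gcd; dividing by that gcd leaves one congruence.\<close>

lemma cong_mult_all_iff:
  fixes n :: nat
  assumes "n > 0"
  shows "(\<forall>a\<in>A. [i * a = j * a] (mod n)) \<longleftrightarrow> [i = j] (mod n div Gcd (insert n A))"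
proof -
  define g where "g = Gcd (insert n A)"
  \<comment> \<open>The difference is taken in the integers to avoid truncated subtraction.\<close>
  define d where "d = nat \<bar>int i - int j\<bar>"
  have cong: "[i * a = j * a] (mod m) \<longleftrightarrow> m dvd d * a" for a m
  proof -
    have "[i * a = j * a] (mod m) \<longleftrightarrow> int m dvd int i * int a - int j * int a"
      by (simp add: cong_iff_dvd_diff flip: cong_int_iff)
    also have "\<dots> \<longleftrightarrow> m dvd nat \<bar>(int i - int j) * int a\<bar>"
      by (simp add: left_diff_distrib)
    also have "nat \<bar>(int i - int j) * int a\<bar> = d * a"
      by (simp add: d_def abs_mult nat_mult_distrib)
    finally show ?thesis .
  qed
  have "g dvd n"
    by (simp add: g_def)
  then obtain m where m: "n = m * g"
    by (metis dvd_def mult.commute)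
  have "g > 0"
    using m assms by (cases g) auto
  \<comment> \<open>Adjoining \<open>n\<close> to \<open>A\<close> is free because \<open>n\<close>
    divides \<open>d * n\<close>, and it makes the gcd a divisor of \<open>n\<close>.\<close>
  have "(\<forall>a\<in>A. n dvd d * a) \<longleftrightarrow> n dvd Gcd ((*) d ` insert n A)"
    by (subst dvd_Gcd_iff) auto
  also have "Gcd ((*) d ` insert n A) = d * g"
    unfolding g_def by (subst Gcd_mult) simp
  also have "n dvd d * g \<longleftrightarrow> m dvd d"
    using \<open>g > 0\<close> by (simp add: m)
  also have "m dvd d \<longleftrightarrow> [i = j] (mod m)"
    using cong[of 1 m] by simp
  also have "m = n div g"
    using \<open>g > 0\<close> by (simp add: m)
  finally show ?thesis
    by (simp add: cong g_def)
qed

text \<open>The range splits into \<open>g\<close> blocks of length \<open>m\<close>, each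
  containing one member of the residue class.\<close>

lemma card_cong_lessThan:
  fixes m g :: nat
  assumes "m > 0"
  shows "card {j. j < m * g \<and> [i = j] (mod m)} = g"
proof -
  have "{j. j < m * g \<and> [i = j] (mod m)} = (\<lambda>t. i mod m + m * t) ` {..<g}"
  proof (intro equalityI subsetI)
    fix j assume "j \<in> {j. j < m * g \<and> [i = j] (mod m)}"
    then have j: "j < m * g" "i mod m = j mod m"
      by (auto simp: cong_def)
    have "j = i mod m + m * (j div m)"
      by (simp add: j(2))
    moreover have "j div m < g"
      using j(1) by (simp add: less_mult_imp_div_less mult.commute)
    ultimately show "j \<in> (\<lambda>t. i mod m + m * t) ` {..<g}"
      by blast
  next
    fix j assume "j \<in> (\<lambda>t. i mod m + m * t) ` {..<g}"
    then obtain t where t: "t < g" "j = i mod m + m * t"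
      by auto
    have "j < m * Suc t"
      using assms by (simp add: t(2))
    also have "\<dots> \<le> m * g"
      using t(1) by (intro mult_le_mono2) simp
    finally show "j \<in> {j. j < m * g \<and> [i = j] (mod m)}"
      by (simp add: cong_def t(2))
  qed
  moreover have "inj_on (\<lambda>t. i mod m + m * t) {..<g}"
    using assms by (auto intro!: inj_onI)
  ultimately show ?thesis
    by (simp add: card_image)
qed

text \<open>For each of the \<open>n\<close> values of \<open>i\<close>, the condition on
  \<open>j\<close> is one congruence modulo \<open>n div g\<close>, with exactly \<open>g\<close>
  solutions below \<open>n\<close>.\<close>

lemma sum_of_bool_cong_mult:
  fixes n :: nat
  assumes "n > 0"
  shows "(\<Sum>i<n. \<Sum>j<n. of_bool (\<forall>a\<in>A. [i * a = j * a] (mod n))) =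
           (of_nat (n * Gcd (insert n A)) :: 'a :: semiring_1)"
proof -
  define g where "g = Gcd (insert n A)"
  define m where "m = n div g"
  have "g dvd n"
    by (simp add: g_def)
  then have n: "n = m * g"
    by (simp add: m_def)
  have "(\<Sum>j<n. of_bool (\<forall>a\<in>A. [i * a = j * a] (mod n))) = (of_nat g :: 'a)" for i
  proof -
    have "{..<n} \<inter> {j. [i = j] (mod m)} = {j. j < m * g \<and> [i = j] (mod m)}"
      using n by auto
    moreover have "m > 0"
      using assms n by simp
    ultimately have "(\<Sum>j<n. of_bool ([i = j] (mod m))) = (of_nat g :: 'a)"
      by (simp add: card_cong_lessThan)
    then show ?thesis
      by (simp only: cong_mult_all_iff[OF assms] flip: g_def m_def)
  qed
  then show ?thesis
    by (simp add: g_def)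
qed

section \<open>Irregularity of End(I) and the number of loops\<close>

lemma Irr_End_circle:
  fixes \<alpha> :: "nat \<Rightarrow> nat"
  assumes q: "exp_factor q" "ram q = \<beta>"
    and keys: "Poly_Mapping.keys q = (\<lambda>m. - (of_nat (\<alpha> m) / of_nat \<beta>)) ` {..p}"
    and dec: "\<And>i j. i < j \<Longrightarrow> j \<le> p \<Longrightarrow> \<alpha> j < \<alpha> i"
  shows "Irr_End (circle q) =
           (\<Sum>k\<le>p. (of_nat (Gcd (insert \<beta> (\<alpha> ` {..<k}))) - of_nat (Gcd (insert \<beta> (\<alpha> ` {..k}))))
                     * of_nat (\<alpha> k))"
proof -
  define r where "r = circle_rep (circle q)"
  have r: "exp_factor r" "Poly_Mapping.keys r = Poly_Mapping.keys q"
    using exp_factor_circle_rep[OF q(1)] by (simp_all add: r_def)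
  have ram: "ram r = \<beta>"
    using ram_keys_cong[OF r(2)] q(2) by simp
  have pos: "\<beta> > 0"
    using ram_pos[OF q(1)] q(2) by simp
  \<comment> \<open>The gcd of \<beta> with the first \<open>k\<close> exponents; in particular
    \<open>G 0\<close> is \<beta>.\<close>
  define G where "G = (\<lambda>k. Gcd (insert \<beta> (\<alpha> ` {..<k})))"
  define C where "C = (\<lambda>k i j. \<forall>m<k. [i * \<alpha> m = j * \<alpha> m] (mod \<beta>))"
  have count: "(\<Sum>i<\<beta>. \<Sum>j<\<beta>. of_bool (C k i j)) = (of_nat \<beta> * of_nat (G k) :: rat)" for k
  proof -
    have "C k i j \<longleftrightarrow> (\<forall>a\<in>\<alpha> ` {..<k}. [i * a = j * a] (mod \<beta>))" for i j
      by (auto simp: C_def)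
    then show ?thesis
      by (simp only: sum_of_bool_cong_mult[OF pos] G_def of_nat_mult)
  qed
  have "Irr_End (circle q) = (\<Sum>i<\<beta>. \<Sum>j<\<beta>. slope (galois_conj r i - galois_conj r j))"
    by (simp add: Irr_End_def circle_ram_def ram flip: r_def)
  also have "\<dots> = (\<Sum>i<\<beta>. \<Sum>j<\<beta>. \<Sum>k\<le>p. of_nat (\<alpha> k) / of_nat \<beta> *
                     (of_bool (C k i j) - of_bool (C (Suc k) i j)))"
    unfolding C_def
    by (intro sum.cong refl slope_galois_conj_diff[OF r(1) ram]) (use r(2) keys dec in auto)
  \<comment> \<open>With \<open>k\<close> outermost, the inner sums count pairs; the factor \<beta>
    in each count then cancels the denominator of the slope.\<close>
  also have "\<dots> = (\<Sum>k\<le>p. \<Sum>i<\<beta>. \<Sum>j<\<beta>. of_nat (\<alpha> k) / of_nat \<beta> *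
                     (of_bool (C k i j) - of_bool (C (Suc k) i j)))"
    by (subst (2) sum.swap, subst sum.swap) (rule refl)
  also have "\<dots> = (\<Sum>k\<le>p. of_nat (\<alpha> k) / of_nat \<beta> *
                     (of_nat \<beta> * of_nat (G k) - of_nat \<beta> * of_nat (G (Suc k))))"
    by (simp only: sum_subtractf count flip: sum_distrib_left)
  also have "\<dots> = (\<Sum>k\<le>p. (of_nat (G k) - of_nat (G (Suc k))) * of_nat (\<alpha> k))"
    using pos by (intro sum.cong) (auto simp: field_simps)
  finally show ?thesis
    by (simp add: G_def lessThan_Suc_atMost)
qed

theorem lemma4p6:
  fixes q :: puiseux and p \<beta> :: nat and \<alpha> :: "nat \<Rightarrow> nat" and b :: "nat \<Rightarrow> complex"
  assumes "exp_factor q"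
    and "ram q = \<beta>"
    and "q = (\<Sum>j\<le>p. Poly_Mapping.single (- (of_nat (\<alpha> j) / of_nat \<beta>)) (b j))"
    and "\<And>j. j \<le> p \<Longrightarrow> b j \<noteq> 0"
    and "\<And>i j. i < j \<Longrightarrow> j \<le> p \<Longrightarrow> \<alpha> j < \<alpha> i"
    and "slope q > 1"
  shows "num_loops (circle q) =
           (of_nat \<beta> - of_nat (gcd (\<alpha> 0) \<beta>)) * of_nat (\<alpha> 0)
           + (\<Sum>k=1..p. (of_nat (Gcd (insert \<beta> (\<alpha> ` {..<k}))) - of_nat (Gcd (insert \<beta> (\<alpha> ` {..k}))))
                          * of_nat (\<alpha> k))
           - (of_nat \<beta>)\<^sup>2 + 1
         \<and> (coprime (\<alpha> 0) \<beta> \<longrightarrow>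
              num_loops (circle q) = (of_nat \<beta> - 1) * (of_nat (\<alpha> 0) - of_nat \<beta> - 1))"
proof -
  let ?G = "\<lambda>A. of_nat (Gcd (insert \<beta> (\<alpha> ` A))) :: rat"
  have pos: "\<beta> > 0"
    using ram_pos[OF assms(1)] assms(2) by simp
  \<comment> \<open>Strict decrease keeps the exponents distinct, so the support of \<open>q\<close>
    consists of all \<open>p + 1\<close> of them.\<close>
  have inj: "inj_on \<alpha> {..p}"
    by (rule linorder_inj_onI') (use assms(5) in fastforce)
  have "inj_on (\<lambda>j. - (of_nat (\<alpha> j) / of_nat \<beta> :: rat)) {..p}"
    using pos inj by (auto simp: inj_on_def)
  then have keys: "Poly_Mapping.keys q = (\<lambda>j. - (of_nat (\<alpha> j) / of_nat \<beta>)) ` {..p}"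
    unfolding assms(3) by (rule keys_sum_single[rotated]) (use assms(4) in auto)
  have "circle_ram (circle q) = \<beta>"
    using ram_keys_cong[OF exp_factor_circle_rep(2)[OF assms(1)]] assms(2)
    by (simp add: circle_ram_def)
  moreover have "Irr_End (circle q) =
      (of_nat \<beta> - of_nat (gcd (\<alpha> 0) \<beta>)) * of_nat (\<alpha> 0)
      + (\<Sum>k=1..p. (?G {..<k} - ?G {..k}) * of_nat (\<alpha> k))"
    \<comment> \<open>The term \<open>k = 0\<close> is split off: its first gcd is over the
      singleton of \<beta>, its second is \<open>gcd (\<alpha> 0) \<beta>\<close>.\<close>
    using sum.atLeast_Suc_atMost[of 0 p "\<lambda>k. (?G {..<k} - ?G {..k}) * of_nat (\<alpha> k)"]
    by (simp add: Irr_End_circle[OF assms(1,2) keys assms(5)] gcd.commute flip: atMost_atLeast0)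
  ultimately have main: "num_loops (circle q) =
      (of_nat \<beta> - of_nat (gcd (\<alpha> 0) \<beta>)) * of_nat (\<alpha> 0)
      + (\<Sum>k=1..p. (?G {..<k} - ?G {..k}) * of_nat (\<alpha> k)) - (of_nat \<beta>)\<^sup>2 + 1"
    by (simp only: num_loops_def)
  have "num_loops (circle q) = (of_nat \<beta> - 1) * (of_nat (\<alpha> 0) - of_nat \<beta> - 1)"
    if "coprime (\<alpha> 0) \<beta>"
  proof -
    \<comment> \<open>For \<open>k \<ge> 1\<close> both index sets contain 0, so every term after
      the first is 1 - 1 times an exponent. What remains factors through
      \<open>\<beta>^2 - 1 = (\<beta> - 1) * (\<beta> + 1)\<close>.\<close>
    have "Gcd (insert \<beta> (\<alpha> ` A)) = 1" if "0 \<in> A" for A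
    proof -
      have "Gcd (insert \<beta> (\<alpha> ` A)) dvd gcd (\<alpha> 0) \<beta>"
        using that by (intro gcd_greatest Gcd_dvd) auto
      then show ?thesis
        using \<open>coprime (\<alpha> 0) \<beta>\<close> by simp
    qed
    then have "(\<Sum>k=1..p. (?G {..<k} - ?G {..k}) * of_nat (\<alpha> k)) = 0"
      by (intro sum.neutral) auto
    then show ?thesis
      unfolding main using that by (simp add: power2_eq_square algebra_simps)
  qed
  with main show ?thesis
    by blast
qed

end
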